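(* Let $d\ge2$ and consider the infinite color urn model with colors indexed by $\mathbb{Z}^d$ associated with the random walk with increments $\{X_j\}_{j\ge1}$, and let $Z_n$ be the color of the $(n+1)$-th selected ball. Assume that $\mathbb{P}(X_1=\pm e_i)=\frac{1}{2d}$ for $1\le i\le d$, where $e_i$ is the $i$-th standard unit vector. Then, as $n\to\infty$, $$\sup_{x\in\mathcal{L}_n^{(d)}}\left|d^{-\frac d2}\left(\sqrt{\log n}\right)^d\,\mathbb{P}\left(\frac{\sqrt d}{\sqrt{\log n}}Z_n=x\right)-\phi_d(x)\right|\longrightarrow0,$$ where $\mathcal{L}_n^{(d)}=\left\{\frac{1}{\sqrt{\log n}}z: z\in\sqrt d\,\mathbb{Z}^d\right\}$ for $n\ge2$.
   Context: $\{X_j\}_{j\ge1}$ are i.i.d. random vectors in $\mathbb{Z}^d$ with probability mass function $p(u)=\mathbb{P}(X_1=u)$. Urn model: let $R=((p(v-u)))_{u,v\in\mathbb{Z}^d}$ and let $R_u$ be the $u$-th row of $R$. The initial configuration $U_0=(U_{0,v})_{v\in\mathbb{Z}^d}$ is a (non-random) probability vector with only finitely many non-zero entries. For $n\ge0$, the color $Z_n\in\mathbb{Z}^d$ of the $(n+1)$-th selected ball satisfies $\mathbb{P}(Z_n=v\mid U_n,\dots,U_0)=U_{n,v}/(n+1)$, $v\in\mathbb{Z}^d$, and $U_{n+1}=U_n+R_{Z_n}$, i.e. $U_{n+1,v}=U_{n,v}+p(v-Z_n)$. (So $\sum_v U_{n,v}=n+1$.) $\phi_d(x)=(2\pi)^{-d/2}e^{-\|x\|^2/2}$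 is the standard Gaussian density on $\mathbb{R}^d$. *)

theory Defs
  imports "HOL-Probability.Probability"
begin

definition real_vec :: "int ^ 'd \<Rightarrow> real ^ 'd::finite" where
  "real_vec z = (\<chi> i. real_of_int (z $ i))"

definition std_gaussian_density :: "real ^ 'd::finite \<Rightarrow> real" where
  "std_gaussian_density x =
     (2 * pi) powr (- real CARD('d) / 2) * exp (- (norm x)\<^sup>2 / 2)"

definition scaled_lattice :: "nat \<Rightarrow> (real ^ 'd::finite) set" where
  "scaled_lattice n =
     {(1 / sqrt (ln (real n))) *\<^sub>R z | z.
        z \<in> range (\<lambda>w :: int ^ 'd. sqrt (real CARD('d)) *\<^sub>R real_vec w)}"

text \<open>The sequence is indexed from 1; the value of \<open>X 0\<close> is irrelevant.\<close>

locale iid_increments = prob_space N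
  for N :: "'b measure" +
  fixes X :: "nat \<Rightarrow> 'b \<Rightarrow> int ^ 'd::finite"
  assumes indep_increments: "indep_vars (\<lambda>_. count_space UNIV) X {1..}"
    and identically_distributed:
      "\<And>j. j \<ge> 1 \<Longrightarrow> distr N (count_space UNIV) (X j) = distr N (count_space UNIV) (X 1)"

definition replacement_matrix :: "(int ^ 'd \<Rightarrow> real) \<Rightarrow> int ^ 'd::finite \<Rightarrow> int ^ 'd \<Rightarrow> real" where
  "replacement_matrix p u v = p (v - u)"

text \<open>The sigma-algebra generated by the random configurations \<open>U 0, \<dots>, U n\<close>, i.e. by all of
  their coordinates.\<close>

definition urn_history ::
  "'a measure \<Rightarrow> (nat \<Rightarrow> 'a \<Rightarrow> int ^ 'd::finite \<Rightarrow> real) \<Rightarrow> nat \<Rightarrow> 'a measure" where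
  "urn_history M U n =
     sigma (space M)
       {(\<lambda>\<omega>. U k \<omega> v) -` A \<inter> space M | k v A. k \<le> n \<and> A \<in> sets (borel :: real measure)}"

locale infinite_color_urn = prob_space M
  for M :: "'a measure" +
  fixes p :: "int ^ 'd::finite \<Rightarrow> real"
    and U\<^sub>0 :: "int ^ 'd \<Rightarrow> real"
    and U :: "nat \<Rightarrow> 'a \<Rightarrow> int ^ 'd \<Rightarrow> real"
    and Z :: "nat \<Rightarrow> 'a \<Rightarrow> int ^ 'd"
  assumes initial_finite_support: "finite {v. U\<^sub>0 v \<noteq> 0}"
    and initial_nonneg: "\<And>v. U\<^sub>0 v \<ge> 0"
    and initial_sum: "(\<Sum>v | U\<^sub>0 v \<noteq> 0. U\<^sub>0 v) = 1"
    and configuration_measurable: "\<And>n v. (\<lambda>\<omega>. U n \<omega> v) \<in> borel_measurable M"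
    and color_measurable: "\<And>n. Z n \<in> measurable M (count_space UNIV)"
    and configuration_initial: "\<And>\<omega>. \<omega> \<in> space M \<Longrightarrow> U 0 \<omega> = U\<^sub>0"
    and color_conditional_prob:
      "\<And>n v. AE \<omega> in M.
         real_cond_exp M (urn_history M U n) (indicator {\<omega> \<in> space M. Z n \<omega> = v}) \<omega>
           = U n \<omega> v / (real n + 1)"
    and configuration_update:
      "\<And>n \<omega> v. \<omega> \<in> space M \<Longrightarrow> U (Suc n) \<omega> v = U n \<omega> v + replacement_matrix p (Z n \<omega>) v"

end

theory Submission
  imports Defs "HOL-Analysis.Harmonic_Numbers"
begin

text \<open>Averaging the conditional law of the colors shows that the law of \<open>Z n\<close> is obtained from the
  initial configuration by \<open>n\<close> independent lazy steps: in step \<open>j\<close> an increment is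
  added with probability \<open>1 / (j + 1)\<close> (\<open>color_mass_Suc\<close>). With
  \<open>\<phi>(t) = (1/d) (\<Sum>i. cos (t i))\<close>, its characteristic function is that of the
  initial configuration times \<open>\<Prod>j<n. (1 - (1 - \<phi>(t)) / (j + 2))\<close>
  (\<open>char_sum_color_mass\<close>), which behaves like \<open>exp (- (1 - \<phi>(t)) ln n)\<close>: the
  urn runs the simple random walk for a time of order \<open>ln n\<close>. The laws have finite support, so
  finite sums suffice throughout.

  With the lattice spacing \<open>c = sqrt (d / ln n)\<close>, Fourier inversion represents the rescaled
  mass at \<open>v\<close> as an integral over the box \<open>[- \<pi>/c, \<pi>/c]\<^sup>d\<close>, and the Gaussian
  density at \<open>c v\<close> as an integral over the whole space, both against the same unimodular kernel.
  Hence the supremum over the lattice is at most \<open>(2 \<pi>)\<close> to the power \<open>- d\<close> times the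
  \<open>L\<^sup>1\<close> distance between the truncated characteristic function at \<open>c s\<close> and
  \<open>exp (- \<bar>s\<bar>\<^sup>2 / 2)\<close> (\<open>local_limit_error_le\<close>).

  That distance tends to zero by dominated convergence. The pointwise limit holds because
  \<open>(1 - \<phi>(c s)) ln n\<close> tends to \<open>\<bar>s\<bar>\<^sup>2 / 2\<close> (\<open>scaled_char_sum_tendsto\<close>).
  Since \<open>1 - cos t \<ge> 2 t\<^sup>2 / \<pi>\<^sup>2\<close> for \<open>\<bar>t\<bar> \<le> \<pi>\<close>, a multiple of
  \<open>exp (- 2 \<bar>s\<bar>\<^sup>2 / \<pi>\<^sup>2)\<close> dominates on the whole box (\<open>scaled_char_sum_bound\<close>).
  The periodicity of the simple random walk does no harm: at
  \<open>t = (\<pi>, \<dots>, \<pi>)\<close>, where the characteristic function of the walk has modulus one, the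
  factor for \<open>j = 0\<close> is zero.\<close>

section \<open>Characteristic functions of finitely supported functions on the lattice\<close>

definition char_sum :: "(int ^ 'd::finite \<Rightarrow> real) \<Rightarrow> ('d \<Rightarrow> real) \<Rightarrow> complex" where
  "char_sum q t = (\<Sum>v | q v \<noteq> 0. of_real (q v) * cis (\<Sum>i\<in>UNIV. t i * real_of_int (v $ i)))"

lemma char_sum_superset:
  assumes "finite V" "{v. q v \<noteq> 0} \<subseteq> V"
  shows "char_sum q t = (\<Sum>v\<in>V. of_real (q v) * cis (\<Sum>i\<in>UNIV. t i * real_of_int (v $ i)))"
  unfolding char_sum_def using assms by (intro sum.mono_neutral_left) auto

lemma char_sum_zero: "char_sum q (\<lambda>i. 0) = of_real (\<Sum>v | q v \<noteq> 0. q v)"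
  by (simp add: char_sum_def)

lemma tendsto_char_sum:
  assumes "\<And>i. ((\<lambda>x. t x i) \<longlongrightarrow> l i) F"
  shows "((\<lambda>x. char_sum q (t x)) \<longlongrightarrow> char_sum q l) F"
  unfolding char_sum_def cis_conv_exp by (intro tendsto_intros assms)

lemma norm_char_sum_le: "(\<And>v. 0 \<le> q v) \<Longrightarrow> norm (char_sum q t) \<le> (\<Sum>v | q v \<noteq> 0. q v)"
  unfolding char_sum_def by (rule order_trans[OF norm_sum]) (simp add: norm_mult)

lemma support_translate:
  fixes q :: "int ^ 'd::finite \<Rightarrow> real"
  shows "{v. q (v - u) \<noteq> 0} = (\<lambda>v. v + u) ` {v. q v \<noteq> 0}"
  by (force simp: image_iff intro: exI[of _ "_ - u"])

lemma finite_support_translate: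
  fixes q :: "int ^ 'd::finite \<Rightarrow> real"
  assumes "finite {v. q v \<noteq> 0}"
  shows "finite {v. q (v - u) \<noteq> 0}"
  using assms by (simp add: support_translate)

lemma char_sum_translate:
  assumes "finite {v. q v \<noteq> 0}"
  shows "char_sum (\<lambda>v. q (v - u)) t = cis (\<Sum>i\<in>UNIV. t i * real_of_int (u $ i)) * char_sum q t"
proof -
  show ?thesis unfolding char_sum_def support_translate
    by (subst sum.reindex)
       (auto simp: inj_on_def sum_distrib_left cis_mult algebra_simps sum.distrib intro!: sum.cong)
qed

text \<open>The supports of the summands may differ, and cancellation may make the support of the
  combination smaller than their union; all sums are therefore compared over one common finite
  superset.\<close>

lemma char_sum_linear:
  assumes "finite {v. f v \<noteq> 0}" "finite S" "\<And>u. u \<in> S \<Longrightarrow> finite {v. g u v \<noteq> 0}"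
  shows "finite {v. a * f v + (\<Sum>u\<in>S. b u * g u v) \<noteq> 0}"
    and "char_sum (\<lambda>v. a * f v + (\<Sum>u\<in>S. b u * g u v)) t
         = of_real a * char_sum f t + (\<Sum>u\<in>S. of_real (b u) * char_sum (g u) t)"
proof -
  define V where "V = {v. f v \<noteq> 0} \<union> (\<Union>u\<in>S. {v. g u v \<noteq> 0})"
  have V: "finite V" using assms by (auto simp: V_def)
  have sub: "{v. a * f v + (\<Sum>u\<in>S. b u * g u v) \<noteq> 0} \<subseteq> V"
  proof safe
    fix v assume *: "a * f v + (\<Sum>u\<in>S. b u * g u v) \<noteq> 0"
    show "v \<in> V"
    proof (rule ccontr)
      assume "v \<notin> V"
      then have "f v = 0" "\<And>u. u \<in> S \<Longrightarrow> g u v = 0" by (auto simp: V_def)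
      with * show False by simp
    qed
  qed
  show "finite {v. a * f v + (\<Sum>u\<in>S. b u * g u v) \<noteq> 0}" using finite_subset[OF sub V] .
  have f: "char_sum f t = (\<Sum>v\<in>V. of_real (f v) * cis (\<Sum>i\<in>UNIV. t i * real_of_int (v $ i)))"
    by (rule char_sum_superset[OF V]) (auto simp: V_def)
  have g: "char_sum (g u) t = (\<Sum>v\<in>V. of_real (g u v) * cis (\<Sum>i\<in>UNIV. t i * real_of_int (v $ i)))"
    if "u \<in> S" for u
    using that by (intro char_sum_superset[OF V]) (auto simp: V_def)
  have "(\<Sum>u\<in>S. of_real (b u) * char_sum (g u) t)
      = (\<Sum>u\<in>S. \<Sum>v\<in>V. of_real (b u) * (of_real (g u v) * cis (\<Sum>i\<in>UNIV. t i * real_of_int (v $ i))))"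
    by (intro sum.cong) (auto simp: g sum_distrib_left)
  also have "\<dots> = (\<Sum>v\<in>V. \<Sum>u\<in>S. of_real (b u) * (of_real (g u v) * cis (\<Sum>i\<in>UNIV. t i * real_of_int (v $ i))))"
    by (rule sum.swap)
  finally show "char_sum (\<lambda>v. a * f v + (\<Sum>u\<in>S. b u * g u v)) t
         = of_real a * char_sum f t + (\<Sum>u\<in>S. of_real (b u) * char_sum (g u) t)"
    by (simp add: char_sum_superset[OF V sub] f sum_distrib_left sum_distrib_right
          sum.distrib algebra_simps)
qed

section \<open>The law of the selected color\<close>

context infinite_color_urn
begin

definition color_mass :: "nat \<Rightarrow> int ^ 'd \<Rightarrow> real" where
  "color_mass n v = prob {\<omega> \<in> space M. Z n \<omega> = v}"

lemma color_event [measurable]: "{\<omega> \<in> space M. Z n \<omega> = v} \<in> sets M"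
  using measurable_sets[OF color_measurable[of n], of "{v}"]
  by (simp add: vimage_def Int_def conj_commute)

lemma subalgebra_urn_history: "subalgebra M (urn_history M U n)"
  unfolding subalgebra_def urn_history_def
proof
  let ?A = "{(\<lambda>\<omega>. U k \<omega> v) -` A \<inter> space M | k v A. k \<le> n \<and> A \<in> sets (borel :: real measure)}"
  have sub: "?A \<subseteq> Pow (space M)" by auto
  show "space (sigma (space M) ?A) = space M" by (rule space_measure_of[OF sub])
  have "?A \<subseteq> sets M"
    using measurable_sets[OF configuration_measurable] by auto
  then show "sets (sigma (space M) ?A) \<subseteq> sets M"
    by (subst sets_measure_of[OF sub]) (rule sets.sigma_sets_subset)
qed

text \<open>Integrating the conditional law of the color given the history leaves the mean configuration,
  so the law of \<open>Z n\<close> is the normalised mean configuration and no dependence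
  between the draws has to be tracked.\<close>

lemma expectation_configuration: "expectation (\<lambda>\<omega>. U n \<omega> v) = (real n + 1) * color_mass n v"
proof -
  interpret H: finite_measure_subalgebra M "urn_history M U n"
    by standard (rule subalgebra_urn_history)
  let ?I = "indicator {\<omega> \<in> space M. Z n \<omega> = v} :: 'a \<Rightarrow> real"
  have "integrable M ?I" by (simp add: less_top[symmetric])
  then have "expectation (real_cond_exp M (urn_history M U n) ?I) = expectation ?I"
    by (rule H.real_cond_exp_int)
  also have "\<dots> = color_mass n v" by (simp add: color_mass_def)
  also have "expectation (real_cond_exp M (urn_history M U n) ?I)
           = expectation (\<lambda>\<omega>. U n \<omega> v / (real n + 1))"
    using color_conditional_prob[of n v] configuration_measurable[of n v]
    by (intro integral_cong_AE) (auto intro: borel_measurable_cond_exp2)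
  finally show ?thesis by (simp add: field_simps)
qed

lemma replacement_eq_sum:
  assumes "finite {u. p u \<noteq> 0}" "\<omega> \<in> space M"
  shows "replacement_matrix p (Z n \<omega>) v
       = (\<Sum>u | p u \<noteq> 0. p u * indicator {\<omega> \<in> space M. Z n \<omega> = v - u} \<omega>)"
proof -
  have "(\<Sum>u | p u \<noteq> 0. p u * indicator {\<omega> \<in> space M. Z n \<omega> = v - u} \<omega>)
      = (\<Sum>u | p u \<noteq> 0. if u = v - Z n \<omega> then p u else 0)"
    using assms(2) by (intro sum.cong) (auto simp: indicator_def)
  also have "\<dots> = p (v - Z n \<omega>)" using assms(1) by (simp add: sum.delta)
  finally show ?thesis by (simp add: replacement_matrix_def)
qed

lemma integrable_configuration:
  assumes "finite {u. p u \<noteq> 0}"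
  shows "integrable M (\<lambda>\<omega>. U n \<omega> v)"
proof (induction n)
  case 0
  show ?case
    by (subst Bochner_Integration.integrable_cong[where g = "\<lambda>_. U\<^sub>0 v"]) (auto simp: configuration_initial)
next
  case (Suc n)
  have "integrable M (\<lambda>\<omega>. U n \<omega> v + (\<Sum>u | p u \<noteq> 0. p u * indicator {\<omega> \<in> space M. Z n \<omega> = v - u} \<omega>))"
    using Suc by (auto simp: less_top[symmetric])
  then show ?case
    by (subst Bochner_Integration.integrable_cong[OF refl]) (auto simp: configuration_update replacement_eq_sum[OF assms])
qed

lemma color_mass_0: "color_mass 0 = U\<^sub>0"
proof
  fix v
  have "expectation (\<lambda>\<omega>. U 0 \<omega> v) = expectation (\<lambda>_. U\<^sub>0 v)"
    by (intro Bochner_Integration.integral_cong) (auto simp: configuration_initial)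
  then show "color_mass 0 v = U\<^sub>0 v"
    by (simp add: expectation_configuration prob_space)
qed

text \<open>The expected update of the configuration: the normalising total grows from \<open>n + 1\<close> to
  \<open>n + 2\<close>, and the added ball is the convolution of the current law with the
  increment law. As far as laws are concerned, an independent increment is added to the current
  color with probability \<open>1 / (n + 2)\<close>, and otherwise the color is kept.\<close>

lemma color_mass_Suc:
  assumes "finite {u. p u \<noteq> 0}"
  shows "color_mass (Suc n) v = (real n + 1) / (real n + 2) * color_mass n v
           + (\<Sum>u | p u \<noteq> 0. p u / (real n + 2) * color_mass n (v - u))"
proof -
  have "(real n + 2) * color_mass (Suc n) v = expectation (\<lambda>\<omega>. U (Suc n) \<omega> v)"
    by (simp add: expectation_configuration)
  also have "\<dots> = expectation (\<lambda>\<omega>. U n \<omega> v + (\<Sum>u | p u \<noteq> 0. p u * indicator {\<omega> \<in> space M. Z n \<omega> = v - u} \<omega>))"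
    by (intro Bochner_Integration.integral_cong) (auto simp: configuration_update replacement_eq_sum[OF assms])
  also have "\<dots> = (real n + 1) * color_mass n v + (\<Sum>u | p u \<noteq> 0. p u * color_mass n (v - u))"
    using integrable_configuration[OF assms]
    by (subst Bochner_Integration.integral_add)
       (auto simp: less_top[symmetric] expectation_configuration color_mass_def)
  finally have "color_mass (Suc n) v
      = ((real n + 1) * color_mass n v + (\<Sum>u | p u \<noteq> 0. p u * color_mass n (v - u))) / (real n + 2)"
    by (simp add: eq_divide_eq mult.commute)
  also have "\<dots> = (real n + 1) / (real n + 2) * color_mass n v
           + (\<Sum>u | p u \<noteq> 0. p u / (real n + 2) * color_mass n (v - u))"
    unfolding add_divide_distrib[of "_ * _"] sum_divide_distrib by simp
  finally show ?thesis .
qed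

lemma finite_support_color_mass:
  assumes "finite {u. p u \<noteq> 0}"
  shows "finite {v. color_mass n v \<noteq> 0}"
proof (induction n)
  case 0
  then show ?case by (simp add: color_mass_0 initial_finite_support)
next
  case (Suc n)
  show ?case unfolding color_mass_Suc[OF assms]
    by (rule char_sum_linear(1)[OF Suc assms]) (rule finite_support_translate[OF Suc])
qed

text \<open>Convolution becomes multiplication, so the recursion for the laws multiplies the characteristic
  function by \<open>(n + 1 + char_sum p t) / (n + 2)\<close> in each step.\<close>

lemma char_sum_color_mass:
  assumes "finite {u. p u \<noteq> 0}"
  shows "char_sum (color_mass n) t
       = char_sum U\<^sub>0 t * (\<Prod>j<n. 1 - (1 - char_sum p t) / of_nat (j + 2))"
proof (induction n)
  case 0
  then show ?case by (simp add: color_mass_0)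
next
  case (Suc n)
  have nz: "(of_nat n + 2 :: complex) \<noteq> 0"
    using of_nat_neq_0[of "Suc n", where 'a = complex] by (simp add: add_ac)
  note fin = finite_support_color_mass[OF assms, of n]
  have "char_sum (color_mass (Suc n)) t
      = char_sum (\<lambda>v. (real n + 1) / (real n + 2) * color_mass n v
           + (\<Sum>u | p u \<noteq> 0. p u / (real n + 2) * color_mass n (v - u))) t"
    by (rule arg_cong[where f = "\<lambda>q. char_sum q t"]) (rule ext, rule color_mass_Suc[OF assms])
  also have "\<dots> = of_real ((real n + 1) / (real n + 2)) * char_sum (color_mass n) t
     + (\<Sum>u | p u \<noteq> 0. of_real (p u / (real n + 2)) * char_sum (\<lambda>v. color_mass n (v - u)) t)"
    by (rule char_sum_linear(2)[OF fin assms]) (rule finite_support_translate[OF fin])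
  also have "\<dots> = of_real ((real n + 1) / (real n + 2)) * char_sum (color_mass n) t
     + char_sum p t / (of_nat n + 2) * char_sum (color_mass n) t"
    unfolding char_sum_translate[OF fin]
    by (simp add: char_sum_def[of p] sum_distrib_left sum_distrib_right sum_divide_distrib mult_ac)
  also have "\<dots> = char_sum (color_mass n) t * (1 - (1 - char_sum p t) / of_nat (n + 2))"
  proof -
    have "a * C + f / w * C = C * (1 - (1 - f) / w)" if "w \<noteq> 0" "a = (w - 1) / w" for w a f C :: complex
    proof -
      have eq: "1 - (1 - f) / w = a + f / w" using that by (simp add: field_simps)
      show ?thesis unfolding eq by (simp add: algebra_simps)
    qed
    from this[of "of_nat n + 2" "(of_nat n + 1) / (of_nat n + 2)"] nz
    show ?thesis by (simp add: add.commute)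
  qed
  finally show ?case by (simp add: Suc)
qed

end

section \<open>Simple random walk increments\<close>

lemma axis_neq_uminus_axis: "axis i (1::int) \<noteq> - axis j 1"
proof
  assume "axis i (1::int) = - axis j 1"
  then have "axis i (1::int) $ i = (- axis j 1) $ i" by simp
  then show False by (simp add: axis_def split: if_splits)
qed

text \<open>The \<open>2 d\<close> unit steps are distinct and their probabilities already add up to one, so
  every other value has probability zero.\<close>

lemma (in prob_space) simple_increment_mass:
  fixes Y :: "'a \<Rightarrow> int ^ 'd::finite"
  assumes Y: "Y \<in> measurable M (count_space UNIV)"
    and pos: "\<And>i. prob {\<omega> \<in> space M. Y \<omega> = axis i 1} = 1 / (2 * real CARD('d))"
    and neg: "\<And>i. prob {\<omega> \<in> space M. Y \<omega> = - axis i 1} = 1 / (2 * real CARD('d))"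
  shows "prob {\<omega> \<in> space M. Y \<omega> = u}
       = (if u \<in> range (\<lambda>i. axis i 1) \<union> range (\<lambda>i. - axis i 1) then 1 / (2 * real CARD('d)) else 0)"
proof -
  let ?A = "range (\<lambda>i::'d. axis i (1::int))" and ?B = "range (\<lambda>i::'d. - axis i (1::int))"
  let ?E = "\<lambda>u. {\<omega> \<in> space M. Y \<omega> = u}"
  have E: "?E u \<in> events" for u
    using measurable_sets[OF Y, of "{u}"] by (simp add: vimage_def Int_def conj_commute)
  have disj: "?A \<inter> ?B = {}"
    using axis_neq_uminus_axis by blast
  have cA: "card ?A = CARD('d)" by (subst card_image) (auto simp: inj_on_def axis_eq_axis)
  have cB: "card ?B = CARD('d)" by (subst card_image) (auto simp: inj_on_def axis_eq_axis)
  have "prob (\<Union>u\<in>?A \<union> ?B. ?E u) = (\<Sum>u\<in>?A \<union> ?B. prob (?E u))"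
    using E by (intro finite_measure_finite_Union) (auto simp: disjoint_family_on_def)
  also have "\<dots> = (\<Sum>u\<in>?A \<union> ?B. 1 / (2 * real CARD('d)))"
    by (intro sum.cong) (auto simp: pos neg)
  also have "\<dots> = 1"
    using card_Un_disjoint[OF _ _ disj] cA cB by simp
  finally have one: "prob (\<Union>u\<in>?A \<union> ?B. ?E u) = 1" .
  show ?thesis
  proof (cases "u \<in> ?A \<union> ?B")
    case True
    then show ?thesis by (auto simp: pos neg)
  next
    case False
    have "prob ((\<Union>u\<in>?A \<union> ?B. ?E u) \<union> ?E u) = prob (\<Union>u\<in>?A \<union> ?B. ?E u) + prob (?E u)"
      using False E by (intro finite_measure_Union) auto
    then have "prob (?E u) \<le> 0"
      using one prob_le_1[of "(\<Union>u\<in>?A \<union> ?B. ?E u) \<union> ?E u"] by linarith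
    with False show ?thesis using measure_nonneg[of M "?E u"] by auto
  qed
qed

lemma char_sum_simple_random_walk:
  assumes p: "\<And>u :: int ^ 'd::finite. p u
     = (if u \<in> range (\<lambda>i. axis i 1) \<union> range (\<lambda>i. - axis i 1) then 1 / (2 * real CARD('d)) else 0)"
  shows "finite {u. p u \<noteq> 0}"
    and "char_sum p t = of_real (1 - (\<Sum>i\<in>UNIV. 1 - cos (t i)) / real CARD('d))"
proof -
  let ?A = "range (\<lambda>i::'d. axis i (1::int))" and ?B = "range (\<lambda>i::'d. - axis i (1::int))"
  have supp: "{u. p u \<noteq> 0} \<subseteq> ?A \<union> ?B" by (auto simp: p)
  have fin: "finite (?A \<union> ?B)" by simp
  show "finite {u. p u \<noteq> 0}" using finite_subset[OF supp fin] .
  have disj: "?A \<inter> ?B = {}"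
    using axis_neq_uminus_axis by blast
  have ax: "(\<Sum>i\<in>UNIV. t i * real_of_int (axis k (1::int) $ i)) = t k" for k :: 'd
  proof -
    have "t i * real_of_int (axis k (1::int) $ i) = (if i = k then t k else 0)" for i
      by (simp add: axis_def)
    then show ?thesis by simp
  qed
  let ?c = "complex_of_real (1 / (2 * real CARD('d)))"
  have "char_sum p t = (\<Sum>v\<in>?A. of_real (p v) * cis (\<Sum>i\<in>UNIV. t i * real_of_int (v $ i)))
                     + (\<Sum>v\<in>?B. of_real (p v) * cis (\<Sum>i\<in>UNIV. t i * real_of_int (v $ i)))"
    unfolding char_sum_superset[OF fin supp] by (rule sum.union_disjoint) (use disj in auto)
  also have "(\<Sum>v\<in>?A. of_real (p v) * cis (\<Sum>i\<in>UNIV. t i * real_of_int (v $ i)))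
      = (\<Sum>k\<in>UNIV. ?c * cis (t k))"
    by (subst sum.reindex) (auto simp: inj_on_def axis_eq_axis p ax intro!: sum.cong)
  also have "(\<Sum>v\<in>?B. of_real (p v) * cis (\<Sum>i\<in>UNIV. t i * real_of_int (v $ i)))
      = (\<Sum>k\<in>UNIV. ?c * cis (- t k))"
    by (subst sum.reindex) (auto simp: inj_on_def axis_eq_axis p ax sum_negf intro!: sum.cong)
  also have "(\<Sum>k\<in>UNIV. ?c * cis (t k)) + (\<Sum>k\<in>UNIV. ?c * cis (- t k))
      = (\<Sum>k\<in>UNIV. of_real (cos (t k) / real CARD('d)))"
    unfolding sum.distrib[symmetric] by (intro sum.cong) (auto simp: complex_eq_iff)
  also have "\<dots> = of_real (1 - (\<Sum>i\<in>UNIV. 1 - cos (t i)) / real CARD('d))"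
    unfolding of_real_sum[symmetric] sum_subtractf
    by (simp add: field_simps sum_divide_distrib)
  finally show "char_sum p t = of_real (1 - (\<Sum>i\<in>UNIV. 1 - cos (t i)) / real CARD('d))" .
qed

section \<open>Asymptotics of the product\<close>

lemma harm_eq_sum_shift: "harm (Suc n) - 1 = (\<Sum>j<n. 1 / real (j + 2))"
proof (induction n)
  case (Suc n)
  have "harm (Suc (Suc n)) = harm (Suc n) + 1 / real (n + 2)"
    by (subst harm_Suc) (simp add: inverse_eq_divide)
  with Suc show ?case by simp
qed (simp add: harm_Suc harm_expand)

text \<open>The range \<open>0 \<le> e \<le> 2\<close> is the one taken by \<open>1 - char_sum p t\<close> for the
  simple random walk. All factors are nonnegative there because the smallest denominator is
  \<open>2\<close>; this is how the urn escapes the parity obstruction of the simple random walk, whose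
  characteristic function has modulus one at \<open>t = (\<pi>, \<dots>, \<pi>)\<close>.\<close>

lemma urn_product_le:
  assumes "0 \<le> e" "e \<le> 2"
  shows "0 \<le> (\<Prod>j<n. 1 - e / real (j + 2))"
    and "(\<Prod>j<n. 1 - e / real (j + 2)) \<le> exp (- e * (harm (Suc n) - 1))"
proof -
  have f: "0 \<le> 1 - e / real (j + 2)" for j using assms by (simp add: field_simps)
  then show "0 \<le> (\<Prod>j<n. 1 - e / real (j + 2))" by (intro prod_nonneg) auto
  have "(\<Prod>j<n. 1 - e / real (j + 2)) \<le> (\<Prod>j<n. exp (- (e / real (j + 2))))"
    using f exp_minus_ge by (intro prod_mono) auto
  also have "\<dots> = exp (- e * (harm (Suc n) - 1))"
    by (simp add: exp_sum[symmetric] harm_eq_sum_shift sum_distrib_left sum_negf)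
  finally show "(\<Prod>j<n. 1 - e / real (j + 2)) \<le> exp (- e * (harm (Suc n) - 1))" .
qed

text \<open>From \<open>1 - x \<ge> exp (- x - 2 x\<^sup>2)\<close> on \<open>[0, 1/2]\<close>; the quadratic error
  is summed crudely, by bounding one factor \<open>2 / (j + 2)\<close> by \<open>1\<close>, since
  \<open>e\<^sup>2\<close> times a harmonic sum still vanishes in the limit.\<close>

lemma urn_product_ge:
  assumes "0 \<le> e" "e \<le> 1"
  shows "exp (- (e + e\<^sup>2) * (harm (Suc n) - 1)) \<le> (\<Prod>j<n. 1 - e / real (j + 2))"
proof -
  have "exp (- (e + e\<^sup>2) * (harm (Suc n) - 1)) = (\<Prod>j<n. exp (- (e + e\<^sup>2) * (1 / real (j + 2))))"
    unfolding harm_eq_sum_shift sum_distrib_left by (rule exp_sum) simp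
  also have "\<dots> \<le> (\<Prod>j<n. 1 - e / real (j + 2))"
  proof (intro prod_mono conjI)
    fix j
    let ?x = "e / real (j + 2)"
    have x: "0 \<le> ?x" "?x \<le> 1 / 2" using assms by (auto simp: field_simps)
    have "2 * ?x\<^sup>2 = e\<^sup>2 * (1 / real (j + 2)) * (2 / real (j + 2))"
      by (simp add: power2_eq_square)
    also have "\<dots> \<le> e\<^sup>2 * (1 / real (j + 2)) * 1"
      by (intro mult_left_mono) auto
    finally have "2 * ?x\<^sup>2 \<le> e\<^sup>2 * (1 / real (j + 2))" by simp
    moreover have "- (e + e\<^sup>2) * (1 / real (j + 2)) = - ?x - e\<^sup>2 * (1 / real (j + 2))"
      by (simp add: diff_divide_distrib)
    ultimately have "- (e + e\<^sup>2) * (1 / real (j + 2)) \<le> - ?x - 2 * ?x\<^sup>2"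
      by linarith
    also have "\<dots> \<le> ln (1 - ?x)" by (rule ln_one_minus_pos_lower_bound[OF x])
    finally have "exp (- (e + e\<^sup>2) * (1 / real (j + 2))) \<le> exp (ln (1 - ?x))" by simp
    also have "\<dots> = 1 - ?x" using x by (subst exp_ln) auto
    finally show "exp (- (e + e\<^sup>2) * (1 / real (j + 2))) \<le> 1 - ?x" .
  qed simp
  finally show ?thesis .
qed

text \<open>Both bounds have exponent \<open>- e n * harm n\<close> up to vanishing terms, and
  \<open>harm n - ln n\<close> converges, so the harmonic number may be replaced by the logarithm.\<close>

lemma urn_product_tendsto:
  assumes e: "e \<longlonglongrightarrow> 0" and eL: "(\<lambda>n. e n * ln (real n)) \<longlonglongrightarrow> l" and nonneg: "\<And>n. 0 \<le> e n"
  shows "(\<lambda>n. \<Prod>j<n. 1 - e n / real (j + 2)) \<longlonglongrightarrow> exp (- l)"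
proof -
  have "(\<lambda>n. e n * ln (real n) + e n * (harm n - ln (real n)) + e n * (1 / real (Suc n) - 1))
      \<longlonglongrightarrow> l + 0 * euler_mascheroni + 0 * (0 - 1)"
    by (intro tendsto_add tendsto_mult e eL euler_mascheroni_LIMSEQ tendsto_diff LIMSEQ_Suc[OF lim_1_over_n] tendsto_const)
  also have "(\<lambda>n. e n * ln (real n) + e n * (harm n - ln (real n)) + e n * (1 / real (Suc n) - 1))
      = (\<lambda>n. e n * (harm (Suc n) - 1))"
    by (auto simp: harm_Suc algebra_simps inverse_eq_divide)
  finally have eH: "(\<lambda>n. e n * (harm (Suc n) - 1)) \<longlonglongrightarrow> l" by simp
  have "(\<lambda>n. exp (- ((1 + e n) * (e n * (harm (Suc n) - 1))))) \<longlonglongrightarrow> exp (- ((1 + 0) * l))"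
    by (intro tendsto_intros e eH)
  also have "(\<lambda>n. exp (- ((1 + e n) * (e n * (harm (Suc n) - 1)))))
           = (\<lambda>n. exp (- (e n + (e n)\<^sup>2) * (harm (Suc n) - 1)))"
    by (simp add: algebra_simps power2_eq_square)
  finally have lower: "(\<lambda>n. exp (- (e n + (e n)\<^sup>2) * (harm (Suc n) - 1))) \<longlonglongrightarrow> exp (- l)" by simp
  have upper: "(\<lambda>n. exp (- e n * (harm (Suc n) - 1))) \<longlonglongrightarrow> exp (- l)"
    using tendsto_exp[OF tendsto_minus[OF eH]] by simp
  have small: "\<forall>\<^sub>F n in sequentially. e n < 1" using order_tendstoD(2)[OF e] by simp
  show ?thesis
  proof (rule tendsto_sandwich[OF _ _ lower upper])
    show "\<forall>\<^sub>F n in sequentially. exp (- (e n + (e n)\<^sup>2) * (harm (Suc n) - 1))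
        \<le> (\<Prod>j<n. 1 - e n / real (j + 2))"
      using small by eventually_elim (rule urn_product_ge[OF nonneg less_imp_le])
    show "\<forall>\<^sub>F n in sequentially. (\<Prod>j<n. 1 - e n / real (j + 2))
        \<le> exp (- e n * (harm (Suc n) - 1))"
      using small
    proof eventually_elim
      case (elim n)
      with nonneg[of n] show ?case by (intro urn_product_le(2)) auto
    qed
  qed
qed

text \<open>Jordan's inequality \<open>sin y \<ge> 2 y / \<pi>\<close> on \<open>[0, \<pi>/2]\<close>, from the concavity
  of the sine, applied at the half angle. It supplies a Gaussian majorant on the whole
  fundamental box, so that the frequencies need not be split into small and large ones.\<close>

lemma one_minus_cos_ge:
  assumes "\<bar>t\<bar> \<le> pi"
  shows "2 * t\<^sup>2 / pi\<^sup>2 \<le> 1 - cos t"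
proof -
  have "concave_on {0..pi/2} sin"
    by (rule f''_le0_imp_concave[where f' = cos and f'' = "\<lambda>x. - sin x"])
       (auto intro!: derivative_eq_intros sin_ge_zero)
  from concave_onD_Icc'[OF this, of "\<bar>t\<bar> / 2"] assms
  have "\<bar>t\<bar> / pi \<le> sin (\<bar>t\<bar> / 2)" by (simp add: field_simps)
  then have "(\<bar>t\<bar> / pi)\<^sup>2 \<le> (sin (\<bar>t\<bar> / 2))\<^sup>2" by (intro power_mono) auto
  moreover have "cos t = 1 - 2 * (sin (\<bar>t\<bar> / 2))\<^sup>2"
    using cos_double_sin[of "\<bar>t\<bar> / 2"] by simp
  ultimately show ?thesis by (simp add: power_divide)
qed

text \<open>By the half-angle formula the quotient equals
  \<open>s\<^sup>2 / 2 * (sinc (c n * s / 2))\<^sup>2\<close>.\<close>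

lemma one_minus_cos_scaled_tendsto:
  fixes c :: "'a \<Rightarrow> real"
  assumes "filterlim c (at_right 0) F"
  shows "((\<lambda>n. (1 - cos (c n * s)) / (c n)\<^sup>2) \<longlongrightarrow> s\<^sup>2 / 2) F"
proof -
  have c0: "(c \<longlongrightarrow> 0) F" and pos: "\<forall>\<^sub>F n in F. c n > 0"
    using assms by (auto simp: filterlim_at eventually_conj_iff)
  have lim: "((\<lambda>n. s\<^sup>2 / 2 * (sinc (c n * s / 2))\<^sup>2) \<longlongrightarrow> s\<^sup>2 / 2 * (sinc (0 * s / 2))\<^sup>2) F"
    by (intro tendsto_mult tendsto_power tendsto_divide tendsto_const c0
          isCont_tendsto_compose[OF isCont_sinc]) auto
  have "\<forall>\<^sub>F n in F. s\<^sup>2 / 2 * (sinc (c n * s / 2))\<^sup>2 = (1 - cos (c n * s)) / (c n)\<^sup>2"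
    using pos
  proof eventually_elim
    case (elim n)
    have "cos (c n * s) = 1 - 2 * (sin (c n * s / 2))\<^sup>2"
      using cos_double_sin[of "c n * s / 2"] by simp
    with elim show ?case
      by (cases "s = 0") (simp_all add: power_divide power_mult_distrib)
  qed
  from Lim_transform_eventually[OF lim this] show ?thesis by simp
qed

section \<open>Fourier inversion\<close>

text \<open>Integrals over frequencies are taken over the product of one-dimensional Lebesgue measures,
  indexed by the coordinates, because every integral that has to be evaluated has an integrand
  that is a finite sum of products of functions of single coordinates.\<close>

abbreviation coordinate_lborel :: "('d::finite \<Rightarrow> real) measure" where
  "coordinate_lborel \<equiv> Pi\<^sub>M UNIV (\<lambda>_. lborel)"

lemma product_sigma_finite_lborel: "product_sigma_finite (\<lambda>_. lborel)"
  by standard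

lemma coordinatewise_prod:
  fixes f :: "'d::finite \<Rightarrow> real \<Rightarrow> 'b::{real_normed_field,banach,second_countable_topology}"
  assumes "\<And>i. integrable lborel (f i)"
  shows "integrable coordinate_lborel (\<lambda>s. \<Prod>i\<in>UNIV. f i (s i))"
    and "(\<integral>s. (\<Prod>i\<in>UNIV. f i (s i)) \<partial>coordinate_lborel) = (\<Prod>i\<in>UNIV. \<integral>x. f i x \<partial>lborel)"
  using product_sigma_finite.product_integrable_prod[OF product_sigma_finite_lborel finite assms]
    product_sigma_finite.product_integral_prod[OF product_sigma_finite_lborel finite assms]
  by auto

lemma cis_sum: "finite A \<Longrightarrow> cis (\<Sum>i\<in>A. f i) = (\<Prod>i\<in>A. cis (f i))"
  by (induction A rule: finite_induct) (simp_all flip: cis_mult)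

text \<open>The frequency variable is already rescaled by \<open>c\<close>, so no multidimensional change of
  variables is needed later. For \<open>k \<noteq> 0\<close> the primitive takes equal values at both
  ends because they differ by a period.\<close>

lemma cis_orthogonality:
  fixes c :: real and k :: int
  assumes "0 < c"
  shows "integrable lborel (\<lambda>x. indicator {- pi / c..pi / c} x *\<^sub>R cis (x * (c * real_of_int k)))"
    and "(\<integral>x. indicator {- pi / c..pi / c} x *\<^sub>R cis (x * (c * real_of_int k)) \<partial>lborel)
       = (if k = 0 then of_real (2 * pi / c) else 0)"
proof -
  have cont: "continuous_on {- pi / c..pi / c} (\<lambda>x. cis (x * (c * real_of_int k)))"
    by (intro continuous_intros)
  show "integrable lborel (\<lambda>x. indicator {- pi / c..pi / c} x *\<^sub>R cis (x * (c * real_of_int k)))"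
    by (rule borel_integrable_compact[OF _ cont]) simp
  have le: "- pi / c \<le> pi / c" using assms by (simp add: field_simps)
  show "(\<integral>x. indicator {- pi / c..pi / c} x *\<^sub>R cis (x * (c * real_of_int k)) \<partial>lborel)
       = (if k = 0 then of_real (2 * pi / c) else 0)"
  proof (cases "k = 0")
    case True
    have "(\<integral>x. indicator {- pi / c..pi / c} x *\<^sub>R (1::complex) \<partial>lborel)
        = (\<integral>x. indicator {- pi / c..pi / c} x \<partial>lborel) *\<^sub>R 1"
      by (rule integral_scaleR_left)
         (intro integrable_real_indicator; simp add: emeasure_lborel_Icc_eq)
    also have "(\<integral>x. indicator {- pi / c..pi / c} x \<partial>lborel) = 2 * pi / c"
      using le by simp
    finally show ?thesis using True by (simp add: scaleR_conv_of_real)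
  next
    case False
    let ?a = "c * real_of_int k"
    have a: "?a \<noteq> 0" using False assms by simp
    let ?F = "\<lambda>x. cis (x * ?a) / (\<i> * of_real ?a)"
    have "(\<integral>x. indicator {- pi / c..pi / c} x *\<^sub>R cis (x * ?a) \<partial>lborel) = ?F (pi / c) - ?F (- pi / c)"
    proof (rule integral_FTC_Icc[OF le _ cont])
      fix x
      have "((\<lambda>z. exp (\<i> * of_real ?a * z) / (\<i> * of_real ?a)) has_field_derivative
             exp (\<i> * of_real ?a * of_real x)) (at (of_real x))"
        using a by (auto intro!: derivative_eq_intros)
      from has_vector_derivative_real_field[OF this]
      have "((\<lambda>x. exp (\<i> * of_real ?a * of_real x) / (\<i> * of_real ?a)) has_vector_derivative
             exp (\<i> * of_real ?a * of_real x)) (at x within {- pi / c..pi / c})" .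
      then show "(?F has_vector_derivative cis (x * ?a)) (at x within {- pi / c..pi / c})"
        by (simp add: cis_conv_exp mult_ac)
    qed
    also have "\<dots> = 0"
    proof -
      have "cis (pi / c * ?a) = cis (- pi / c * ?a)"
        using assms sin_npi_int[of k] by (simp add: complex_eq_iff mult.commute)
      then show ?thesis by simp
    qed
    finally show ?thesis using False by simp
  qed
qed

definition box_indicator :: "real \<Rightarrow> ('d::finite \<Rightarrow> real) \<Rightarrow> real" where
  "box_indicator r s = (\<Prod>i\<in>UNIV. indicator {- r..r} (s i))"

lemma box_indicator_eq: "box_indicator r s = (if \<forall>i. \<bar>s i\<bar> \<le> r then 1 else 0)"
proof (cases "\<forall>i. \<bar>s i\<bar> \<le> r")
  case True
  then have "indicator {- r..r} (s i) = (1::real)" for i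
    by (simp add: abs_le_iff minus_le_iff)
  with True show ?thesis by (simp add: box_indicator_def)
next
  case False
  then obtain i where "indicator {- r..r} (s i) = (0::real)"
    by (auto simp: abs_le_iff minus_le_iff indicator_def)
  with False show ?thesis by (auto simp: box_indicator_def)
qed

text \<open>The function is a finite sum, so inversion reduces to the orthogonality of characters in each
  coordinate.\<close>

lemma char_sum_inversion:
  fixes q :: "int ^ 'd::finite \<Rightarrow> real" and v :: "int ^ 'd"
  assumes fin: "finite {v. q v \<noteq> 0}" and c: "0 < c"
  defines "f \<equiv> \<lambda>s. box_indicator (pi / c) s *\<^sub>R
      (char_sum q (\<lambda>i. c * s i) * cis (- (\<Sum>i\<in>UNIV. s i * (c * real_of_int (v $ i)))))"
  shows "integrable coordinate_lborel f"
    and "(\<integral>s. f s \<partial>coordinate_lborel) = of_real ((2 * pi / c) ^ CARD('d) * q v)"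
proof -
  let ?g = "\<lambda>w i x. indicator {- pi / c..pi / c} x *\<^sub>R cis (x * (c * real_of_int ((w - v) $ i)))"
  have f_eq: "f = (\<lambda>s. \<Sum>w | q w \<noteq> 0. of_real (q w) * (\<Prod>i\<in>UNIV. ?g w i (s i)))"
  proof
    fix s
    have "cis (\<Sum>i\<in>UNIV. c * s i * real_of_int (w $ i)) * cis (- (\<Sum>i\<in>UNIV. s i * (c * real_of_int (v $ i))))
        = (\<Prod>i\<in>UNIV. cis (s i * (c * real_of_int ((w - v) $ i))))" for w
      unfolding cis_mult by (subst cis_sum[symmetric])
        (simp_all add: sum_subtractf[symmetric] algebra_simps)
    then have "box_indicator (pi / c) s *\<^sub>R (of_real (q w) * cis (\<Sum>i\<in>UNIV. c * s i * real_of_int (w $ i))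
           * cis (- (\<Sum>i\<in>UNIV. s i * (c * real_of_int (v $ i)))))
        = of_real (q w) * (\<Prod>i\<in>UNIV. ?g w i (s i))" for w
      unfolding box_indicator_def scaleR_conv_of_real prod.distrib of_real_prod
      by (simp only: mult.assoc mult.left_commute[of "of_real (q w)"] minus_divide_left)
    then show "f s = (\<Sum>w | q w \<noteq> 0. of_real (q w) * (\<Prod>i\<in>UNIV. ?g w i (s i)))"
      unfolding f_def char_sum_def sum_distrib_right scaleR_sum_right by (intro sum.cong refl)
  qed
  have int: "integrable coordinate_lborel (\<lambda>s. \<Prod>i\<in>UNIV. ?g w i (s i))"
    and val: "(\<integral>s. (\<Prod>i\<in>UNIV. ?g w i (s i)) \<partial>coordinate_lborel)
       = (if w = v then of_real ((2 * pi / c) ^ CARD('d)) else 0)" for w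
  proof -
    note prod = coordinatewise_prod[of "?g w", OF cis_orthogonality(1)[OF c]]
    show "integrable coordinate_lborel (\<lambda>s. \<Prod>i\<in>UNIV. ?g w i (s i))" by (rule prod(1))
    have "(\<integral>s. (\<Prod>i\<in>UNIV. ?g w i (s i)) \<partial>coordinate_lborel)
        = (\<Prod>i\<in>UNIV. if (w - v) $ i = 0 then of_real (2 * pi / c) else 0)"
      unfolding prod(2) by (intro prod.cong refl cis_orthogonality(2)[OF c])
    also have "\<dots> = (if w = v then of_real ((2 * pi / c) ^ CARD('d)) else 0)"
    proof (cases "w = v")
      case False
      then obtain i where "(w - v) $ i \<noteq> 0" by (auto simp: vec_eq_iff)
      then show ?thesis using False by (auto intro!: prod_zero bexI[of _ i])
    qed simp
    finally show "(\<integral>s. (\<Prod>i\<in>UNIV. ?g w i (s i)) \<partial>coordinate_lborel)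
       = (if w = v then of_real ((2 * pi / c) ^ CARD('d)) else 0)" .
  qed
  show "integrable coordinate_lborel f"
    unfolding f_eq using int by (intro Bochner_Integration.integrable_sum integrable_mult_right)
  have "(\<integral>s. f s \<partial>coordinate_lborel) = (\<Sum>w | q w \<noteq> 0. of_real (q w) * (if w = v then of_real ((2 * pi / c) ^ CARD('d)) else 0))"
    unfolding f_eq using int
    by (subst Bochner_Integration.integral_sum)
       (simp_all only: integrable_mult_right integral_mult_right_zero val)
  also have "\<dots> = of_real ((2 * pi / c) ^ CARD('d) * q v)"
    using fin by (cases "q v = 0") (simp_all add: if_distrib[of "(*) _"] sum.delta cong: if_cong)
  finally show "(\<integral>s. f s \<partial>coordinate_lborel) = of_real ((2 * pi / c) ^ CARD('d) * q v)" .
qed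

text \<open>The characteristic function of the standard normal distribution without its normalising constant.\<close>

lemma gaussian_fourier_1d:
  shows "integrable lborel (\<lambda>s. of_real (exp (- s\<^sup>2 / 2)) * cis (- (s * x)))"
    and "(\<integral>s. of_real (exp (- s\<^sup>2 / 2)) * cis (- (s * x)) \<partial>lborel)
       = of_real (sqrt (2 * pi) * exp (- x\<^sup>2 / 2))"
proof -
  have eq: "(\<lambda>s. of_real (exp (- s\<^sup>2 / 2)) * cis (- (s * x)))
     = (\<lambda>s. of_real (sqrt (2 * pi)) * (std_normal_density s *\<^sub>R iexp (- x * s)))"
    by (auto simp: std_normal_density_def cis_conv_exp scaleR_conv_of_real mult_ac real_sqrt_mult)
  have int: "integrable lborel (\<lambda>s. std_normal_density s *\<^sub>R iexp (- x * s))"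
    by (rule Bochner_Integration.integrable_bound[OF integrable_normal_density[where \<mu> = 0 and \<sigma> = 1]])
       (auto simp: norm_mult)
  show "integrable lborel (\<lambda>s. of_real (exp (- s\<^sup>2 / 2)) * cis (- (s * x)))"
    unfolding eq using int by (rule integrable_mult_right)
  have "(\<integral>s. std_normal_density s *\<^sub>R iexp (- x * s) \<partial>lborel) = char std_normal_distribution (- x)"
    unfolding char_def by (subst integral_density) auto
  also have "\<dots> = of_real (exp (- x\<^sup>2 / 2))" by (simp add: char_std_normal_distribution)
  finally have val: "(\<integral>s. std_normal_density s *\<^sub>R iexp (- x * s) \<partial>lborel) = of_real (exp (- x\<^sup>2 / 2))" .
  show "(\<integral>s. of_real (exp (- s\<^sup>2 / 2)) * cis (- (s * x)) \<partial>lborel)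
       = of_real (sqrt (2 * pi) * exp (- x\<^sup>2 / 2))"
    unfolding eq integral_mult_right_zero val by simp
qed

lemma gaussian_fourier:
  fixes x :: "real ^ 'd::finite"
  defines "f \<equiv> \<lambda>s. of_real (exp (- (\<Sum>i\<in>UNIV. (s i)\<^sup>2) / 2)) * cis (- (\<Sum>i\<in>UNIV. s i * x $ i))"
  shows "integrable coordinate_lborel f"
    and "(\<integral>s. f s \<partial>coordinate_lborel) = of_real ((2 * pi) ^ CARD('d) * std_gaussian_density x)"
proof -
  let ?g = "\<lambda>i s. of_real (exp (- s\<^sup>2 / 2)) * cis (- (s * x $ i))"
  have f_eq: "f = (\<lambda>s. \<Prod>i\<in>UNIV. ?g i (s i))"
    by (auto simp: f_def prod.distrib cis_sum[symmetric] exp_sum[symmetric] sum_negf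
          sum_divide_distrib simp flip: of_real_prod)
  note prod = coordinatewise_prod[of ?g, OF gaussian_fourier_1d(1)]
  show "integrable coordinate_lborel f" unfolding f_eq by (rule prod(1))
  have "(\<integral>s. f s \<partial>coordinate_lborel) = (\<Prod>i\<in>UNIV. of_real (sqrt (2 * pi) * exp (- (x $ i)\<^sup>2 / 2)))"
    unfolding f_eq prod(2) by (intro prod.cong refl gaussian_fourier_1d(2))
  also have "\<dots> = of_real (sqrt (2 * pi) ^ CARD('d) * (\<Prod>i\<in>UNIV. exp (- (x $ i)\<^sup>2 / 2)))"
    by (simp add: prod.distrib)
  also have "(\<Prod>i\<in>UNIV. exp (- (x $ i)\<^sup>2 / 2)) = exp (- (norm x)\<^sup>2 / 2)"
    by (simp add: exp_sum[symmetric] norm_vec_def L2_set_def sum_nonneg sum_negf sum_divide_distrib)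
  also have "sqrt (2 * pi) ^ CARD('d) = (2 * pi) ^ CARD('d) * (2 * pi) powr (- real CARD('d) / 2)"
  proof -
    have "sqrt (2 * pi) ^ CARD('d) = (2 * pi) powr (real CARD('d) / 2)"
      by (simp add: powr_half_sqrt[symmetric] powr_powr flip: powr_realpow)
    also have "\<dots> = (2 * pi) powr (real CARD('d)) * (2 * pi) powr (- real CARD('d) / 2)"
      by (simp add: powr_add[symmetric])
    finally show ?thesis by (simp add: powr_realpow)
  qed
  finally show "(\<integral>s. f s \<partial>coordinate_lborel) = of_real ((2 * pi) ^ CARD('d) * std_gaussian_density x)"
    by (simp add: std_gaussian_density_def mult_ac)
qed

text \<open>Each coordinate contributes a multiple of the normal density with standard deviation
  \<open>\<pi> / 2\<close>; the constant \<open>2 / \<pi>\<^sup>2\<close> is the one in Jordan's inequality.\<close>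

lemma integrable_gaussian_majorant:
  "integrable (coordinate_lborel :: ('d::finite \<Rightarrow> real) measure) (\<lambda>s. exp (- (2 / pi\<^sup>2) * (\<Sum>i\<in>UNIV. (s i)\<^sup>2)))"
proof -
  have 1: "integrable lborel (\<lambda>x. exp (- (2 / pi\<^sup>2) * x\<^sup>2))"
  proof -
    have "integrable lborel (\<lambda>x. sqrt (2 * pi * (pi / 2)\<^sup>2) * normal_density 0 (pi / 2) x)"
      by simp
    also have "(\<lambda>x. sqrt (2 * pi * (pi / 2)\<^sup>2) * normal_density 0 (pi / 2) x) = (\<lambda>x. exp (- (2 / pi\<^sup>2) * x\<^sup>2))"
      by (auto simp: normal_density_def power_divide)
    finally show ?thesis .
  qed
  have "(\<lambda>s::'d \<Rightarrow> real. exp (- (2 / pi\<^sup>2) * (\<Sum>i\<in>UNIV. (s i)\<^sup>2))) = (\<lambda>s. \<Prod>i\<in>UNIV. exp (- (2 / pi\<^sup>2) * (s i)\<^sup>2))"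
    by (simp add: exp_sum[symmetric] sum_distrib_left)
  then show ?thesis using coordinatewise_prod(1)[OF 1] by metis
qed

text \<open>The mass \<open>q v\<close> and the Gaussian density are inverse Fourier integrals with the same
  unimodular kernel. The point \<open>v\<close> enters through that kernel alone, so
  taking norms under the integral gives a bound that is uniform in \<open>v\<close>.\<close>

lemma local_limit_error_le:
  fixes q :: "int ^ 'd::finite \<Rightarrow> real"
  assumes fin: "finite {v. q v \<noteq> 0}" and c: "0 < c"
  shows "\<bar>q v / c ^ CARD('d) - std_gaussian_density (c *\<^sub>R real_vec v)\<bar>
     \<le> (\<integral>s. norm (box_indicator (pi / c) s *\<^sub>R char_sum q (\<lambda>i. c * s i)
             - of_real (exp (- (\<Sum>i\<in>UNIV. (s i)\<^sup>2) / 2))) \<partial>coordinate_lborel) / (2 * pi) ^ CARD('d)"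
proof -
  let ?B = "coordinate_lborel :: ('d \<Rightarrow> real) measure"
  let ?e = "\<lambda>s. cis (- (\<Sum>i\<in>UNIV. s i * (c * real_of_int (v $ i))))"
  let ?f = "\<lambda>s. box_indicator (pi / c) s *\<^sub>R (char_sum q (\<lambda>i. c * s i) * ?e s)"
  let ?g = "\<lambda>s. of_real (exp (- (\<Sum>i\<in>UNIV. (s i)\<^sup>2) / 2)) * ?e s"
  let ?h = "\<lambda>s. box_indicator (pi / c) s *\<^sub>R char_sum q (\<lambda>i. c * s i)
             - of_real (exp (- (\<Sum>i\<in>UNIV. (s i)\<^sup>2) / 2))"
  note f = char_sum_inversion[OF fin c, of v]
  have g: "integrable ?B ?g"
    "(\<integral>s. ?g s \<partial>?B) = of_real ((2 * pi) ^ CARD('d) * std_gaussian_density (c *\<^sub>R real_vec v))"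
    using gaussian_fourier[of "c *\<^sub>R real_vec v"] by (simp_all add: real_vec_def)
  have "complex_of_real ((2 * pi) ^ CARD('d) * (q v / c ^ CARD('d) - std_gaussian_density (c *\<^sub>R real_vec v)))
      = (\<integral>s. ?f s \<partial>?B) - (\<integral>s. ?g s \<partial>?B)"
    unfolding f(2) g(2) by (simp add: power_divide right_diff_distrib)
  also have "\<dots> = (\<integral>s. ?f s - ?g s \<partial>?B)"
    using f(1) g(1) by (rule Bochner_Integration.integral_diff[symmetric])
  also have "(\<lambda>s. ?f s - ?g s) = (\<lambda>s. ?h s * ?e s)"
    by (simp add: left_diff_distrib)
  finally have eq: "complex_of_real ((2 * pi) ^ CARD('d) * (q v / c ^ CARD('d) - std_gaussian_density (c *\<^sub>R real_vec v)))
      = (\<integral>s. ?h s * ?e s \<partial>?B)" .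
  have "\<bar>(2 * pi) ^ CARD('d) * (q v / c ^ CARD('d) - std_gaussian_density (c *\<^sub>R real_vec v))\<bar>
      = norm (\<integral>s. ?h s * ?e s \<partial>?B)"
    unfolding eq[symmetric] by (rule norm_of_real[symmetric])
  also have "\<dots> \<le> (\<integral>s. norm (?h s * ?e s) \<partial>?B)" by (rule integral_norm_bound)
  also have "\<dots> = (\<integral>s. norm (?h s) \<partial>?B)" by (simp add: norm_mult)
  finally have "(2 * pi) ^ CARD('d) * \<bar>q v / c ^ CARD('d) - std_gaussian_density (c *\<^sub>R real_vec v)\<bar>
      \<le> (\<integral>s. norm (?h s) \<partial>?B)"
    by (simp add: abs_mult)
  then show ?thesis by (simp add: pos_le_divide_eq mult.commute)
qed

section \<open>The local limit theorem\<close>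

lemma (in infinite_color_urn) char_sum_color_mass_simple_random_walk:
  assumes p: "\<And>u. p u
     = (if u \<in> range (\<lambda>i. axis i 1) \<union> range (\<lambda>i. - axis i 1) then 1 / (2 * real CARD('d)) else 0)"
  shows "char_sum (color_mass n) t = char_sum U\<^sub>0 t *
     of_real (\<Prod>j<n. 1 - ((\<Sum>i\<in>UNIV. 1 - cos (t i)) / real CARD('d)) / real (j + 2))"
  unfolding char_sum_color_mass[OF char_sum_simple_random_walk(1)[OF p]]
    char_sum_simple_random_walk(2)[OF p]
  by simp

text \<open>The spacing of the rescaled lattice, that is, the reciprocal of the standard deviation
  \<open>sqrt (ln n / d)\<close> of one coordinate in the Gaussian approximation of the
  unscaled color.\<close>

definition scaling :: "nat \<Rightarrow> real \<Rightarrow> real" where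
  "scaling n d = sqrt (d / ln (real n))"

lemma scaling_pos: "n \<ge> 2 \<Longrightarrow> d > 0 \<Longrightarrow> scaling n d > 0"
  by (simp add: scaling_def)

lemma scaling_squared: "n \<ge> 2 \<Longrightarrow> d > 0 \<Longrightarrow> (scaling n d)\<^sup>2 = d / ln (real n)"
  by (simp add: scaling_def)

lemma scaling_tendsto: "(\<lambda>n. scaling n d) \<longlonglongrightarrow> 0"
proof -
  have "filterlim (\<lambda>n. ln (real n)) at_top sequentially"
    by (rule filterlim_compose[OF ln_at_top filterlim_real_sequentially])
  then have "(\<lambda>n. d / ln (real n)) \<longlonglongrightarrow> 0"
    by (rule tendsto_divide_0[OF tendsto_const filterlim_at_top_imp_at_infinity])
  then show ?thesis unfolding scaling_def by (rule tendsto_real_sqrt[where x = 0, simplified])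
qed

lemma one_minus_cos_sum_scaling:
  assumes "n \<ge> 2" "d > 0"
  shows "(\<Sum>i\<in>A. 1 - cos (scaling n d * s i)) / d * ln (real n)
       = (\<Sum>i\<in>A. (1 - cos (scaling n d * s i)) / (scaling n d)\<^sup>2)"
  using assms by (simp add: scaling_squared sum_distrib_right sum_divide_distrib)

context infinite_color_urn
begin

text \<open>At frequency \<open>c n * s\<close> the defect \<open>e n = 1 - char_sum p\<close> vanishes while
  \<open>e n * ln n\<close> tends to \<open>(\<Sum>i. (s i)\<^sup>2) / 2\<close>; the initial
  configuration contributes a factor tending to its total mass \<open>1\<close>, and the box eventually
  contains \<open>s\<close>.\<close>

lemma scaled_char_sum_tendsto:
  fixes s :: "'d \<Rightarrow> real"
  assumes p: "\<And>u. p u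
     = (if u \<in> range (\<lambda>i. axis i 1) \<union> range (\<lambda>i. - axis i 1) then 1 / (2 * real CARD('d)) else 0)"
  defines "c \<equiv> \<lambda>n. scaling n (real CARD('d))"
  shows "(\<lambda>n. box_indicator (pi / c n) s *\<^sub>R char_sum (color_mass n) (\<lambda>i. c n * s i))
       \<longlonglongrightarrow> of_real (exp (- (\<Sum>i\<in>UNIV. (s i)\<^sup>2) / 2))"
proof -
  let ?e = "\<lambda>n. (\<Sum>i\<in>UNIV. 1 - cos (c n * s i)) / real CARD('d)"
  have c0: "c \<longlonglongrightarrow> 0" unfolding c_def by (rule scaling_tendsto)
  have large: "\<forall>\<^sub>F n in sequentially. 2 \<le> n" by (rule eventually_ge_at_top)
  have pos: "\<forall>\<^sub>F n in sequentially. c n > 0"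
    using large by eventually_elim (simp add: c_def scaling_pos)
  have right: "filterlim c (at_right 0) sequentially"
    using c0 pos by (auto simp: filterlim_at elim: eventually_mono)
  have cs: "(\<lambda>n. c n * s i) \<longlonglongrightarrow> 0" for i
    using tendsto_mult_right[OF c0, of "s i"] by simp
  have "?e \<longlonglongrightarrow> (\<Sum>i\<in>(UNIV::'d set). 1 - cos 0) / real CARD('d)"
    by (intro tendsto_intros cs) simp
  then have e0: "?e \<longlonglongrightarrow> 0" by simp
  have "(\<lambda>n. \<Sum>i\<in>UNIV. (1 - cos (c n * s i)) / (c n)\<^sup>2) \<longlonglongrightarrow> (\<Sum>i\<in>UNIV. (s i)\<^sup>2 / 2)"
    by (intro tendsto_sum one_minus_cos_scaled_tendsto right)
  moreover have "\<forall>\<^sub>F n in sequentially. (\<Sum>i\<in>UNIV. (1 - cos (c n * s i)) / (c n)\<^sup>2) = ?e n * ln (real n)"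
    using large by eventually_elim (simp only: c_def one_minus_cos_sum_scaling of_nat_0_less_iff zero_less_card_finite)
  ultimately have eL: "(\<lambda>n. ?e n * ln (real n)) \<longlonglongrightarrow> (\<Sum>i\<in>UNIV. (s i)\<^sup>2 / 2)"
    by (rule Lim_transform_eventually)
  have prod: "(\<lambda>n. \<Prod>j<n. 1 - ?e n / real (j + 2)) \<longlonglongrightarrow> exp (- (\<Sum>i\<in>UNIV. (s i)\<^sup>2 / 2))"
    by (rule urn_product_tendsto[OF e0 eL]) (simp add: sum_nonneg)
  have initial: "(\<lambda>n. char_sum U\<^sub>0 (\<lambda>i. c n * s i)) \<longlonglongrightarrow> 1"
    using tendsto_char_sum[of "\<lambda>n i. c n * s i" "\<lambda>_. 0" sequentially U\<^sub>0] cs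
    by (simp add: char_sum_zero initial_sum)
  have "(\<lambda>n. c n * \<bar>s i\<bar>) \<longlonglongrightarrow> 0" for i
    using tendsto_mult_right[OF c0, of "\<bar>s i\<bar>"] by simp
  then have "\<forall>\<^sub>F n in sequentially. c n * \<bar>s i\<bar> < pi" for i
    by (rule order_tendstoD) simp
  then have "\<forall>\<^sub>F n in sequentially. \<forall>i. c n * \<bar>s i\<bar> < pi"
    by (rule eventually_all_finite)
  then have box: "\<forall>\<^sub>F n in sequentially. 1 = box_indicator (pi / c n) s"
    using pos
  proof eventually_elim
    case (elim n)
    then have "\<bar>s i\<bar> \<le> pi / c n" for i
      by (simp add: pos_le_divide_eq mult.commute less_imp_le)
    then show ?case by (simp add: box_indicator_eq)
  qed
  have "(\<lambda>n. box_indicator (pi / c n) s *\<^sub>R (char_sum U\<^sub>0 (\<lambda>i. c n * s i)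
            * of_real (\<Prod>j<n. 1 - ?e n / real (j + 2))))
       \<longlonglongrightarrow> 1 *\<^sub>R (1 * of_real (exp (- (\<Sum>i\<in>UNIV. (s i)\<^sup>2 / 2))))"
    by (intro tendsto_intros initial prod Lim_transform_eventually[OF tendsto_const box])
  then show ?thesis
    by (simp add: char_sum_color_mass_simple_random_walk[OF p] sum_divide_distrib sum_negf)
qed

text \<open>Inside the box all angles lie in \<open>[- \<pi>, \<pi>]\<close>, so Jordan's inequality turns the bound
  \<open>exp (- e * (harm (Suc n) - 1))\<close> on the product into a Gaussian. The constant
  \<open>exp 2\<close> absorbs the \<open>- 1\<close>, as \<open>e \<le> 2\<close>.\<close>

lemma scaled_char_sum_bound:
  fixes s :: "'d \<Rightarrow> real"
  assumes p: "\<And>u. p u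
     = (if u \<in> range (\<lambda>i. axis i 1) \<union> range (\<lambda>i. - axis i 1) then 1 / (2 * real CARD('d)) else 0)"
    and n: "n \<ge> 2"
  defines "c \<equiv> scaling n (real CARD('d))"
  shows "norm (box_indicator (pi / c) s *\<^sub>R char_sum (color_mass n) (\<lambda>i. c * s i))
       \<le> exp 2 * exp (- (2 / pi\<^sup>2) * (\<Sum>i\<in>UNIV. (s i)\<^sup>2))"
proof (cases "\<forall>i. \<bar>s i\<bar> \<le> pi / c")
  case False
  then show ?thesis by (auto simp: box_indicator_eq)
next
  case True
  let ?e = "(\<Sum>i\<in>UNIV. 1 - cos (c * s i)) / real CARD('d)"
  have c: "c > 0" unfolding c_def using n by (simp add: scaling_pos)
  have e: "0 \<le> ?e" "?e \<le> 2"
  proof -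
    show "0 \<le> ?e" by (simp add: sum_nonneg)
    have "(\<Sum>i\<in>UNIV. 1 - cos (c * s i)) \<le> (\<Sum>i\<in>(UNIV::'d set). 2)"
    proof (rule sum_mono)
      fix i show "1 - cos (c * s i) \<le> 2" using cos_ge_minus_one[of "c * s i"] by linarith
    qed
    then show "?e \<le> 2" by (simp add: pos_divide_le_eq)
  qed
  have "(2 / pi\<^sup>2) * (\<Sum>i\<in>UNIV. (s i)\<^sup>2) = (\<Sum>i\<in>UNIV. (2 * (c * s i)\<^sup>2 / pi\<^sup>2) / c\<^sup>2)"
    using c by (simp add: sum_distrib_left power_mult_distrib)
  also have "\<dots> \<le> (\<Sum>i\<in>UNIV. (1 - cos (c * s i)) / c\<^sup>2)"
  proof (intro sum_mono divide_right_mono one_minus_cos_ge)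
    fix i
    show "\<bar>c * s i\<bar> \<le> pi" using True c by (simp add: abs_mult pos_le_divide_eq mult.commute)
  qed simp
  also have "\<dots> = ?e * ln (real n)"
    unfolding c_def by (rule one_minus_cos_sum_scaling[symmetric]) (use n in auto)
  finally have eL: "(2 / pi\<^sup>2) * (\<Sum>i\<in>UNIV. (s i)\<^sup>2) \<le> ?e * ln (real n)" .
  have "ln (real n) \<le> ln (real (Suc n) + 1)" using n by simp
  also have "\<dots> \<le> harm (Suc n)" by (rule harm_ge_ln)
  finally have "?e * ln (real n) \<le> ?e * harm (Suc n)" using e(1) by (rule mult_left_mono)
  then have exponent: "- ?e * (harm (Suc n) - 1) \<le> 2 + - (2 / pi\<^sup>2) * (\<Sum>i\<in>UNIV. (s i)\<^sup>2)"
    using eL e(2) by (simp add: right_diff_distrib)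
  have "norm (char_sum (color_mass n) (\<lambda>i. c * s i))
      = norm (char_sum U\<^sub>0 (\<lambda>i. c * s i)) * (\<Prod>j<n. 1 - ?e / real (j + 2))"
    unfolding char_sum_color_mass_simple_random_walk[OF p] norm_mult norm_of_real
    using urn_product_le(1)[OF e] by simp
  also have "\<dots> \<le> 1 * exp (- ?e * (harm (Suc n) - 1))"
    using norm_char_sum_le[of U\<^sub>0] initial_nonneg initial_sum urn_product_le[OF e]
    by (intro mult_mono) auto
  also have "\<dots> \<le> exp 2 * exp (- (2 / pi\<^sup>2) * (\<Sum>i\<in>UNIV. (s i)\<^sup>2))"
    unfolding exp_add[symmetric] using exponent by simp
  finally show ?thesis using True by (simp add: box_indicator_eq)
qed

text \<open>Dominated convergence. The scaling is degenerate for \<open>n < 2\<close>, where \<open>ln n\<close> is not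
  positive, so the majorant is applied to the sequence shifted by two.\<close>

lemma local_limit_error_tendsto:
  assumes p: "\<And>u. p u
     = (if u \<in> range (\<lambda>i. axis i 1) \<union> range (\<lambda>i. - axis i 1) then 1 / (2 * real CARD('d)) else 0)"
  defines "c \<equiv> \<lambda>n. scaling n (real CARD('d))"
  shows "(\<lambda>n. \<integral>s. norm (box_indicator (pi / c n) s *\<^sub>R char_sum (color_mass n) (\<lambda>i. c n * s i)
             - of_real (exp (- (\<Sum>i\<in>UNIV. (s i)\<^sup>2) / 2))) \<partial>coordinate_lborel) \<longlonglongrightarrow> 0"
proof (rule LIMSEQ_offset[where k = 2])
  let ?B = "coordinate_lborel :: ('d \<Rightarrow> real) measure"
  let ?G = "\<lambda>s :: 'd \<Rightarrow> real. complex_of_real (exp (- (\<Sum>i\<in>UNIV. (s i)\<^sup>2) / 2))"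
  let ?D = "\<lambda>s :: 'd \<Rightarrow> real. exp (- (2 / pi\<^sup>2) * (\<Sum>i\<in>UNIV. (s i)\<^sup>2))"
  let ?f = "\<lambda>n s. box_indicator (pi / c n) s *\<^sub>R char_sum (color_mass n) (\<lambda>i. c n * s i)"
  have meas: "(\<lambda>s. norm (?f n s - ?G s)) \<in> borel_measurable ?B" for n
    unfolding box_indicator_def char_sum_def cis_conv_exp by measurable
  have "(\<lambda>n. \<integral>s. norm (?f (n + 2) s - ?G s) \<partial>?B) \<longlonglongrightarrow> (\<integral>s. 0 \<partial>?B)"
  proof (rule integral_dominated_convergence[where w = "\<lambda>s. (exp 2 + 1) * ?D s"])
    show "integrable ?B (\<lambda>s. (exp 2 + 1) * ?D s)"
      by (intro integrable_mult_right integrable_gaussian_majorant)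
    show "AE s in ?B. (\<lambda>n. norm (?f (n + 2) s - ?G s)) \<longlonglongrightarrow> 0"
    proof (rule AE_I2)
      fix s
      have "(\<lambda>n. ?f (n + 2) s) \<longlonglongrightarrow> ?G s"
        using scaled_char_sum_tendsto[OF p, of s, THEN LIMSEQ_ignore_initial_segment[where k = 2]]
        by (simp only: c_def)
      then show "(\<lambda>n. norm (?f (n + 2) s - ?G s)) \<longlonglongrightarrow> 0"
        by (intro tendsto_norm_zero LIM_zero)
    qed
    show "AE s in ?B. norm (norm (?f (n + 2) s - ?G s)) \<le> (exp 2 + 1) * ?D s" for n
    proof (rule AE_I2)
      fix s :: "'d \<Rightarrow> real"
      have "2 / pi\<^sup>2 \<le> 1 / 2"
        using power_mono[OF pi_ge_two, of 2] by (simp add: field_simps)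
      then have "(2 / pi\<^sup>2) * (\<Sum>i\<in>UNIV. (s i)\<^sup>2) \<le> 1 / 2 * (\<Sum>i\<in>UNIV. (s i)\<^sup>2)"
        by (rule mult_right_mono) (simp add: sum_nonneg)
      then have "norm (?G s) \<le> ?D s" by simp
      moreover have "norm (?f (n + 2) s) \<le> exp 2 * ?D s"
        unfolding c_def by (rule scaled_char_sum_bound[OF p]) simp_all
      ultimately have "norm (?f (n + 2) s - ?G s) \<le> exp 2 * ?D s + ?D s"
        using norm_triangle_ineq4[of "?f (n + 2) s" "?G s"] by linarith
      then show "norm (norm (?f (n + 2) s - ?G s)) \<le> (exp 2 + 1) * ?D s"
        by (simp add: distrib_right)
    qed
  qed (use meas in auto)
  then show "(\<lambda>n. \<integral>s. norm (?f (n + 2) s - ?G s) \<partial>?B) \<longlonglongrightarrow> 0" by simp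
qed

end

lemma scaled_event_eq:
  fixes w z :: "int ^ 'd::finite"
  assumes "c > 0"
  shows "c *\<^sub>R real_vec z = c *\<^sub>R real_vec w \<longleftrightarrow> z = w"
  using assms by (auto simp: real_vec_def vec_eq_iff)

theorem theorem9:
  fixes N :: "'b measure" and M :: "'a measure"
    and X :: "nat \<Rightarrow> 'b \<Rightarrow> int ^ 'd::finite"
    and p U\<^sub>0 :: "int ^ 'd \<Rightarrow> real"
    and U :: "nat \<Rightarrow> 'a \<Rightarrow> int ^ 'd \<Rightarrow> real"
    and Z :: "nat \<Rightarrow> 'a \<Rightarrow> int ^ 'd"
  assumes "CARD('d) \<ge> 2"
    and "iid_increments N X"
    and "\<And>u. p u = measure N {\<omega> \<in> space N. X 1 \<omega> = u}"
    and "\<And>i. measure N {\<omega> \<in> space N. X 1 \<omega> = axis i 1} = 1 / (2 * real CARD('d))"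
    and "\<And>i. measure N {\<omega> \<in> space N. X 1 \<omega> = - axis i 1} = 1 / (2 * real CARD('d))"
    and "infinite_color_urn M p U\<^sub>0 U Z"
  shows "(\<lambda>n. SUP x\<in>(scaled_lattice n :: (real ^ 'd) set).
            \<bar>real CARD('d) powr (- real CARD('d) / 2) * sqrt (ln (real n)) ^ CARD('d)
               * measure M {\<omega> \<in> space M.
                   (sqrt (real CARD('d)) / sqrt (ln (real n))) *\<^sub>R real_vec (Z n \<omega>) = x}
             - std_gaussian_density x\<bar>)
         \<longlonglongrightarrow> 0"
proof -
  interpret N: iid_increments N X by fact
  interpret urn: infinite_color_urn M p U\<^sub>0 U Z by fact
  have "X 1 \<in> measurable N (count_space UNIV)"
    using N.indep_increments by (auto simp: N.indep_vars_def)
  from N.simple_increment_mass[OF this assms(4,5)]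
  have p: "p u = (if u \<in> range (\<lambda>i. axis i 1) \<union> range (\<lambda>i. - axis i 1)
      then 1 / (2 * real CARD('d)) else 0)" for u
    by (simp only: assms(3))
  let ?d = "real CARD('d)"
  let ?c = "\<lambda>n. scaling n ?d"
  let ?err = "\<lambda>n. (\<integral>s. norm (box_indicator (pi / ?c n) s *\<^sub>R char_sum (urn.color_mass n) (\<lambda>i. ?c n * s i)
             - of_real (exp (- (\<Sum>i\<in>UNIV. (s i)\<^sup>2) / 2))) \<partial>coordinate_lborel) / (2 * pi) ^ CARD('d)"
  let ?F = "\<lambda>n x. \<bar>?d powr (- ?d / 2) * sqrt (ln (real n)) ^ CARD('d)
               * measure M {\<omega> \<in> space M. (sqrt ?d / sqrt (ln (real n))) *\<^sub>R real_vec (Z n \<omega>) = x}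
             - std_gaussian_density x\<bar>"
  have err: "?err \<longlonglongrightarrow> 0"
    using tendsto_divide[OF urn.local_limit_error_tendsto[OF p] tendsto_const, of "(2 * pi) ^ CARD('d)"]
    by simp
  have bound: "?F n x \<le> ?err n" if n: "n \<ge> 2" and x: "x \<in> scaled_lattice n" for n x
  proof -
    have c: "?c n > 0" using n by (simp add: scaling_pos)
    have c_eq: "?c n = sqrt ?d / sqrt (ln (real n))" by (simp add: scaling_def real_sqrt_divide)
    from x obtain w where "x = (1 / sqrt (ln (real n))) *\<^sub>R (sqrt ?d *\<^sub>R real_vec w)"
      unfolding scaled_lattice_def by blast
    then have x_eq: "x = ?c n *\<^sub>R real_vec w" by (simp add: c_eq)
    have "measure M {\<omega> \<in> space M. (sqrt ?d / sqrt (ln (real n))) *\<^sub>R real_vec (Z n \<omega>) = x}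
        = urn.color_mass n w"
      unfolding x_eq c_eq[symmetric] scaled_event_eq[OF c] urn.color_mass_def ..
    moreover have "?d powr (- ?d / 2) * sqrt (ln (real n)) ^ CARD('d) = 1 / ?c n ^ CARD('d)"
    proof -
      have "?d powr (- ?d / 2) = 1 / (?d powr (1 / 2)) powr ?d"
        by (simp add: powr_powr powr_minus_divide)
      also have "(?d powr (1 / 2)) powr ?d = sqrt ?d ^ CARD('d)"
        by (simp add: powr_half_sqrt powr_realpow)
      finally show ?thesis by (simp add: c_eq power_divide)
    qed
    ultimately have "?F n x = \<bar>urn.color_mass n w / ?c n ^ CARD('d) - std_gaussian_density (?c n *\<^sub>R real_vec w)\<bar>"
      by (simp add: x_eq)
    also have "\<dots> \<le> ?err n"
      by (rule local_limit_error_le[OF urn.finite_support_color_mass[OF char_sum_simple_random_walk(1)[OF p]] c])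
    finally show ?thesis .
  qed
  have nonempty: "(scaled_lattice n :: (real ^ 'd) set) \<noteq> {}" for n
    by (auto simp: scaled_lattice_def)
  have "\<forall>\<^sub>F n in sequentially. norm (SUP x\<in>(scaled_lattice n :: (real ^ 'd) set). ?F n x) \<le> ?err n"
    using eventually_ge_at_top[of 2]
  proof eventually_elim
    case (elim n)
    let ?S = "SUP x\<in>(scaled_lattice n :: (real ^ 'd) set). ?F n x"
    obtain x :: "real ^ 'd" where x: "x \<in> scaled_lattice n" using nonempty by blast
    have "bdd_above (?F n ` scaled_lattice n)"
      using bound[OF elim] by (auto intro!: bdd_aboveI[of _ "?err n"])
    then have "?F n x \<le> ?S" by (rule cSUP_upper[OF x])
    then have "0 \<le> ?S" by (rule order_trans[OF abs_ge_zero])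
    moreover have "?S \<le> ?err n"
      using nonempty bound[OF elim] by (rule cSUP_least)
    ultimately show ?case by simp
  qed
  then show ?thesis by (rule Lim_null_comparison[OF _ err])
qed

end
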